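(* Let $p$ be an odd prime and suppose that $x,y,z$ are positive integers with $|x-y|=1$ and $$p^x+(2p+1)^y=z^2.$$ Then exactly one of the following holds. (i) $(x,y,z)=(2,1,p+1)$. (ii) The integer $2p+1$ is composite, and there exist integers $k\ge 2$, $a\ge 1$ and $b\ge 0$ with $x=2a$ and $y=2b+1$ such that $p=2k^2-1$, $2p+1=(2k-1)(2k+1)$ with $\gcd(2k-1,2k+1)=1$, $$(2k+1)^{2b+1}-(2k-1)^{2b+1}=2(2k^2-1)^a,$$ and $b<\lceil \log_2(2k^2-1)\rceil$. *)

theory Defs
  imports Complex_Main "HOL-Computational_Algebra.Primes"
begin

definition composite :: "nat \<Rightarrow> bool" where
  "composite n \<longleftrightarrow> n > 1 \<and> \<not> prime n"

end

theory Submission imports Defs "HOL-Computational_Algebra.Nth_Powers" "HOL-Number_Theory.Cong"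
begin

text \<open>
  Exactly one of \<open>x\<close>, \<open>y\<close> is even, so \<open>p ^ x\<close> or \<open>q ^ y\<close>, where \<open>q = 2 * p + 1\<close>, is a difference of
  two squares whose two factors are coprime. If \<open>y = 2 * b\<close>, then \<open>p ^ x = 2 * q ^ b + 1\<close>; hence
  \<open>p\<close> divides \<open>3\<close>, and \<open>3 ^ x = 2 * 7 ^ b + 1\<close> is impossible modulo \<open>7\<close> for odd \<open>x\<close>.
  If \<open>x = 2 * a\<close>, then \<open>v ^ y - u ^ y = 2 * p ^ a\<close> with \<open>u * v = q\<close>. Half of \<open>v - u\<close> divides \<open>p ^ a\<close>,
  so either it is a multiple of \<open>p\<close>, which forces \<open>u = 1\<close> and by size the first solution,
  or \<open>v = u + 2\<close>, the second alternative. The bound on \<open>b\<close> comes from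
  \<open>v ^ (2 * b + 1) - u ^ (2 * b + 1) \<ge> 2 * (v\<^sup>2) ^ b\<close> and \<open>v\<^sup>2 > 2 * p\<close>,
  together with \<open>a \<le> b + 1\<close>.
\<close>

text \<open>Modulo 7, multiplication by 9 permutes 3, 6, 5 cyclically, so odd powers of 3 never
  reach 1.\<close>

lemma even_if_three_power_cong_1_mod_7:
  assumes "[3 ^ x = 1] (mod (7::nat))"
  shows "even x"
proof (rule ccontr)
  assume "odd x"
  then obtain n where "x = 2 * n + 1" by (rule oddE)
  moreover have "3 ^ (2 * n + 1) mod (7::nat) \<in> {3, 5, 6}"
  proof (induction n)
    case (Suc n)
    have "3 ^ (2 * Suc n + 1) mod (7::nat) = 9 * (3 ^ (2 * n + 1) mod 7) mod 7"
      by (simp add: mod_mult_right_eq)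
    then show ?case using Suc by auto
  qed simp
  ultimately show False using assms by (auto simp: cong_def)
qed

text \<open>For \<open>u \<le> v\<close>, replace all but one factor \<open>u\<close> of the
  subtracted power by \<open>v\<close>; otherwise truncated subtraction makes the left side
  0.\<close>

lemma diff_power_odd_ge:
  fixes u v b :: nat
  shows "(v - u) * (v\<^sup>2) ^ b \<le> v ^ (2 * b + 1) - u ^ (2 * b + 1)"
proof (cases "u \<le> v")
  case True
  then have "u ^ (2 * b + 1) \<le> u * v ^ (2 * b)"
    by (simp add: power_mono)
  then have "v * v ^ (2 * b) - u * v ^ (2 * b) \<le> v ^ (2 * b + 1) - u ^ (2 * b + 1)"
    by (simp only: power_add power_one_right mult.commute diff_le_mono2)
  then show ?thesis
    by (simp add: power_mult diff_mult_distrib)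
qed simp

lemma coprime_double_Suc: "coprime p (2 * p + 1)" for p :: nat
  by (rule coprimeI) (metis dvd_add_right_iff dvd_mult)

lemma prime_dvd_if_dvd_power:
  fixes p d n :: nat
  assumes "prime p" "d dvd p ^ n" "d \<noteq> 1"
  shows "p dvd d"
  using assms by (metis divides_primepow_nat dvd_power gr0I power_0)

text \<open>The factors are \<open>r = z - c\<close> and \<open>s = z + c\<close>. Their difference
  \<open>2 * c\<close> is coprime to the odd number \<open>n\<close>, hence to its divisor
  \<open>r\<close>, and so \<open>r\<close> is coprime to \<open>s\<close>.\<close>

lemma square_factorization:
  fixes c n z :: nat
  assumes "c\<^sup>2 + n = z\<^sup>2" and "n > 0" and "odd n" and "coprime c n"
  obtains r s where "z = c + r" "r > 0" "s = r + 2 * c" "r * s = n" "coprime r s"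
proof -
  have "c\<^sup>2 < z\<^sup>2" using assms by linarith
  then have "c < z" by (rule power_less_imp_less_base) simp
  then obtain r where z: "z = c + r" "r > 0" using less_imp_add_positive by blast
  have n: "r * (r + 2 * c) = n"
    using assms(1) z by (simp add: power2_eq_square algebra_simps)
  have "coprime (2 * c) n" using assms by simp
  then have "coprime (2 * c) r" using n by (metis coprime_mult_right_iff)
  then have "coprime r (r + 2 * c)"
    by (metis coprime_commute coprime_iff_gcd_eq_1 gcd_add2 add.commute)
  with z n show thesis using that by blast
qed

lemma no_solution_even_exponent:
  fixes p x b z :: nat
  assumes p: "prime p" "odd p" and "odd x" and "b > 0"
    and eq: "p ^ x + (2 * p + 1) ^ (2 * b) = z\<^sup>2"
  shows False
proof -
  define q where "q = 2 * p + 1"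
  have "coprime p q" unfolding q_def by (rule coprime_double_Suc)
  have "(q ^ b)\<^sup>2 + p ^ x = z\<^sup>2"
    using eq by (simp only: q_def power_even_eq add.commute)
  moreover have "coprime (q ^ b) (p ^ x)"
    using \<open>coprime p q\<close> by (simp add: coprime_commute)
  moreover have "p ^ x > 0" "odd (p ^ x)" using p by (auto simp: prime_gt_0_nat)
  ultimately obtain r s where rs: "r > 0" "s = r + 2 * q ^ b" "r * s = p ^ x" "coprime r s"
    by (metis square_factorization)
  have "q > 0" by (simp add: q_def)
  then have "q ^ b > 0" by simp
  then have "s > 1" using rs(1,2) by linarith
  have dvd: "p dvd d" if "d dvd p ^ x" "d \<noteq> 1" for d
    using that p by (blast intro: prime_dvd_if_dvd_power)
  have "p dvd s" using dvd[of s] \<open>s > 1\<close> by (simp flip: rs(3))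
  \<comment> \<open>Otherwise \<open>p\<close> would divide both of the coprime factors.\<close>
  have "r = 1"
  proof (rule ccontr)
    assume "r \<noteq> 1"
    then have "p dvd r" using dvd[of r] by (simp flip: rs(3))
    with \<open>p dvd s\<close> have "is_unit p" using rs(4) by (blast intro: coprime_common_divisor)
    with p show False by simp
  qed
  then have px: "p ^ x = 1 + 2 * q ^ b" using rs by simp
  \<comment> \<open>Since \<open>q\<close> is 1 modulo \<open>p\<close>, the multiple
    \<open>1 + 2 * q ^ b\<close> of \<open>p\<close> reduces to 3.\<close>
  have "[2 * p + 1 = 0 + 1] (mod p)" by (intro cong_add cong_refl) (simp add: cong_0_iff)
  then have "[q = 1] (mod p)" by (simp add: q_def)
  then have "[1 + 2 * q ^ b = 1 + 2 * 1 ^ b] (mod p)"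
    by (intro cong_add cong_mult cong_pow cong_refl)
  moreover have "p dvd 1 + 2 * q ^ b" using \<open>p dvd s\<close> rs(2) \<open>r = 1\<close> by simp
  ultimately have "p dvd 1 + 2 * 1 ^ b" by (simp only: cong_dvd_iff)
  then have "p \<le> 1 + 2 * 1 ^ b" by (rule dvd_imp_le) simp
  moreover have "p > 1" using p(1) by (rule prime_gt_1_nat)
  moreover have "p \<noteq> 2" using p(2) by auto
  ultimately have "p = 3" by simp
  have "[7 ^ b = 0] (mod (7::nat))"
    using \<open>b > 0\<close> by (simp add: cong_0_iff)
  then have "[1 + 2 * 7 ^ b = 1 + 2 * 0] (mod (7::nat))"
    by (intro cong_add cong_mult cong_refl)
  then have "[3 ^ x = 1] (mod (7::nat))"
    using px unfolding q_def \<open>p = 3\<close> by simp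
  then show False using even_if_three_power_cong_1_mod_7 \<open>odd x\<close> by blast
qed

text \<open>Coprime factors of a perfect power with exponent \<open>2 * b + 1\<close> are themselves
  such powers, of \<open>u\<close> and \<open>v\<close>. The final dichotomy comes from the half gap
  \<open>d\<close> of \<open>u\<close> and \<open>v\<close>, a divisor of
  \<open>p ^ a\<close>.\<close>

lemma odd_exponent_factorization:
  fixes p a b z :: nat
  assumes p: "prime p"
    and eq: "p ^ (2 * a) + (2 * p + 1) ^ (2 * b + 1) = z\<^sup>2"
  obtains u v where "u * v = 2 * p + 1" "coprime u v" "u < v" "z = p ^ a + u ^ (2 * b + 1)"
    "v ^ (2 * b + 1) = u ^ (2 * b + 1) + 2 * p ^ a" "u = 1 \<or> v = u + 2"
proof -
  define q where "q = 2 * p + 1"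
  define n where "n = 2 * b + 1"
  have n: "n > 0" by (simp add: n_def)
  have "coprime p q" unfolding q_def by (rule coprime_double_Suc)
  have "(p ^ a)\<^sup>2 + q ^ n = z\<^sup>2"
    using eq by (simp only: q_def n_def power_even_eq)
  moreover have "coprime (p ^ a) (q ^ n)" "q ^ n > 0" "odd (q ^ n)"
    using \<open>coprime p q\<close> by (simp_all add: q_def)
  ultimately obtain r s where rs: "z = p ^ a + r" "r > 0" "s = r + 2 * p ^ a" "r * s = q ^ n"
      "coprime r s"
    by (metis square_factorization)
  have "is_nth_power n (r * s)" unfolding rs(4) by (rule is_nth_power_nth_power)
  then have "is_nth_power n r" "is_nth_power n s"
    using is_nth_power_mult_coprime_nat_iff rs(5) by blast+
  then obtain u v where uv: "r = u ^ n" "s = v ^ n" by (auto simp: is_nth_power_def)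
  have "(u * v) ^ n = q ^ n" using rs(4) unfolding uv by (simp add: power_mult_distrib)
  then have q: "u * v = q" using n by (intro power_eq_imp_eq_base[of "u * v" n q]) auto
  have "coprime (u ^ n) (v ^ n)" using rs(5) unfolding uv .
  then have "coprime u v" using n by simp
  have vu: "v ^ n = u ^ n + 2 * p ^ a" using rs(3) unfolding uv .
  have "u ^ n < v ^ n" using vu p by (simp add: prime_gt_0_nat)
  then have "u < v" by (rule power_less_imp_less_base) simp
  have "odd (u * v)" using q by (simp add: q_def)
  then have "odd u" "odd v" by auto
  then have "even (v - u)" by simp
  then obtain d where "v - u = 2 * d" by blast
  with \<open>u < v\<close> have d: "v = u + 2 * d" "d > 0" by linarith+
  \<comment> \<open>Integers avoid truncated subtraction; cancelling 2 then leaves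
    \<open>d dvd p ^ a\<close>.\<close>
  have "int v - int u dvd int v ^ n - int u ^ n"
    by (metis dvd_triv_left power_diff_sumr2)
  moreover have "int v ^ n = int u ^ n + 2 * int p ^ a"
    using vu by (metis of_nat_add of_nat_mult of_nat_numeral of_nat_power)
  ultimately have "2 * int d dvd 2 * int (p ^ a)" using d by simp
  then have "d dvd p ^ a" by (simp flip: of_nat_power)
  have "u = 1 \<or> v = u + 2"
  proof (cases "d = 1")
    case False
    then have "p dvd d"
      using \<open>d dvd p ^ a\<close> p by (blast intro: prime_dvd_if_dvd_power)
    then have "p \<le> d" using d by (intro dvd_imp_le) auto
    moreover have "u \<noteq> 0" using \<open>odd u\<close> by (metis even_zero)
    \<comment> \<open>Now \<open>v\<close> is at least the whole product \<open>u * v\<close>, which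
      leaves only \<open>u = 1\<close>.\<close>
    ultimately have "1 + 2 * p \<le> v" using d by simp
    then have "u * (1 + 2 * p) \<le> u * v" by (rule mult_le_mono2)
    also have "\<dots> = 1 * (1 + 2 * p)" using q by (simp add: q_def)
    finally have "u \<le> 1" by (rule mult_right_le_imp_le) simp
    then show ?thesis using \<open>u \<noteq> 0\<close> by simp
  qed (use d in simp)
  moreover have "z = p ^ a + u ^ n" using rs(1) uv(1) by simp
  ultimately show thesis
    using that q \<open>coprime u v\<close> \<open>u < v\<close> vu unfolding q_def n_def by blast
qed

text \<open>If \<open>b > 0\<close>, then \<open>a \<le> 2 * b\<close>, so the right side is at most
  \<open>1 + 2 * N\<close> with \<open>N = (2 * p + 1) ^ (2 * b)\<close>, while the left side is at
  least \<open>5 * N\<close>.\<close>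

lemma exponents_of_trivial_factorization:
  fixes p a b :: nat
  assumes "p > 1" "a \<le> b + 1" and eq: "(2 * p + 1) ^ (2 * b + 1) = 1 + 2 * p ^ a"
  shows "a = 1 \<and> b = 0"
proof (cases "b = 0")
  case True
  then have "p ^ a = p ^ 1" using eq by simp
  then show ?thesis using True \<open>p > 1\<close> by (simp only: power_inject_exp)
next
  case False
  define N where "N = (2 * p + 1) ^ (2 * b)"
  have "p ^ a \<le> p ^ (2 * b)"
    using assms False by (intro power_increasing) auto
  also have "\<dots> \<le> N" unfolding N_def by (intro power_mono) auto
  finally have "p ^ a \<le> N" .
  moreover have "(2 * p + 1) * N = 1 + 2 * p ^ a" using eq by (simp add: N_def)
  moreover have "5 * N \<le> (2 * p + 1) * N" using \<open>p > 1\<close> by (intro mult_right_mono) auto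
  moreover have "N > 0" by (simp add: N_def)
  ultimately show ?thesis by linarith
qed

lemma two_power_less_if_gap_two_factorization:
  fixes p a b u :: nat
  assumes "odd p" "p > 1" "a > 0" "a = b \<or> a = b + 1" and uv: "u * (u + 2) = 2 * p + 1"
    and eq: "(u + 2) ^ (2 * b + 1) = u ^ (2 * b + 1) + 2 * p ^ a"
  shows "2 ^ b < p"
proof -
  have "2 * p \<le> (u + 2)\<^sup>2" using uv by (simp add: power2_eq_square)
  then have "2 * (2 * p) ^ b \<le> 2 * ((u + 2)\<^sup>2) ^ b"
    by (intro mult_left_mono power_mono) auto
  also have "\<dots> \<le> 2 * p ^ a" using diff_power_odd_ge[of "u + 2" u b] eq by simp
  finally have le: "2 ^ b * p ^ b \<le> p ^ a" by (simp add: power_mult_distrib)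
  from assms(4) show ?thesis
  proof
    assume "a = b"
    with le \<open>p > 1\<close> have "(2::nat) ^ b \<le> 1" by simp
    then have "b = 0" using power_increasing_iff[of "2::nat" b 0] by simp
    with \<open>a = b\<close> \<open>a > 0\<close> show ?thesis by simp
  next
    assume "a = b + 1"
    with le \<open>p > 1\<close> have "2 ^ b \<le> p" by simp
    \<comment> \<open>A power of 2 is even or 1, unlike \<open>p\<close>. Strictness is needed for
      the ceiling bound on \<open>b\<close>.\<close>
    moreover have "2 ^ b \<noteq> p" using \<open>odd p\<close> \<open>p > 1\<close> by (cases b) auto
    ultimately show ?thesis by simp
  qed
qed

theorem theorem1:
  fixes p x y z :: nat
  assumes "prime p" and "odd p"
    and "x > 0" and "y > 0" and "z > 0"
    and "\<bar>int x - int y\<bar> = 1"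
    and "p ^ x + (2 * p + 1) ^ y = z ^ 2"
  shows "(x = 2 \<and> y = 1 \<and> z = p + 1) \<longleftrightarrow>
    \<not> (composite (2 * p + 1) \<and>
       (\<exists>(k :: int) (a :: nat) (b :: nat).
          k \<ge> 2 \<and> a \<ge> 1 \<and> b \<ge> 0 \<and>
          x = 2 * a \<and> y = 2 * b + 1 \<and>
          int p = 2 * k ^ 2 - 1 \<and>
          int (2 * p + 1) = (2 * k - 1) * (2 * k + 1) \<and>
          gcd (2 * k - 1) (2 * k + 1) = 1 \<and>
          (2 * k + 1) ^ (2 * b + 1) - (2 * k - 1) ^ (2 * b + 1) = 2 * (2 * k ^ 2 - 1) ^ a \<and>
          int b < \<lceil>log 2 (real_of_int (2 * k ^ 2 - 1))\<rceil>))"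
proof -
  define ii where "ii \<longleftrightarrow> composite (2 * p + 1) \<and>
       (\<exists>(k :: int) (a :: nat) (b :: nat).
          k \<ge> 2 \<and> a \<ge> 1 \<and> b \<ge> 0 \<and>
          x = 2 * a \<and> y = 2 * b + 1 \<and>
          int p = 2 * k ^ 2 - 1 \<and>
          int (2 * p + 1) = (2 * k - 1) * (2 * k + 1) \<and>
          gcd (2 * k - 1) (2 * k + 1) = 1 \<and>
          (2 * k + 1) ^ (2 * b + 1) - (2 * k - 1) ^ (2 * b + 1) = 2 * (2 * k ^ 2 - 1) ^ a \<and>
          int b < \<lceil>log 2 (real_of_int (2 * k ^ 2 - 1))\<rceil>)"
  note p = \<open>prime p\<close> \<open>odd p\<close>
  have "p > 1" using p(1) by (rule prime_gt_1_nat)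
  \<comment> \<open>The alternatives exclude each other: \<open>a = 1\<close> and
    \<open>b = 0\<close> would give \<open>2 = 2 * (2 * k\<^sup>2 - 1)\<close>, impossible for
    \<open>k \<ge> 2\<close>.\<close>
  have "\<not> (x = 2 \<and> y = 1 \<and> ii)"
  proof
    assume "x = 2 \<and> y = 1 \<and> ii"
    then obtain k :: int where "k \<ge> 2" "(2 * k + 1) - (2 * k - 1) = 2 * (2 * k\<^sup>2 - 1)"
      by (auto simp: ii_def)
    moreover have "k\<^sup>2 \<ge> 2\<^sup>2" using \<open>k \<ge> 2\<close> by (intro power_mono) auto
    ultimately show False by simp
  qed
  moreover have "(x = 2 \<and> y = 1 \<and> z = p + 1) \<or> ii"
  proof -
    have parity: "even x \<longleftrightarrow> odd y" using assms(6) by presburger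
    have "even x"
    proof (rule ccontr)
      assume "odd x"
      with parity obtain b where "y = 2 * b" by blast
      with assms \<open>odd x\<close> show False using no_solution_even_exponent[of p x b z] by auto
    qed
    with parity obtain a b where ab: "x = 2 * a" "y = 2 * b + 1" by (metis evenE oddE)
    have "a > 0" using ab assms by simp
    have "a = b \<or> a = b + 1" using ab assms(6) by linarith
    obtain u v where uv: "u * v = 2 * p + 1" "coprime u v" "u < v" "z = p ^ a + u ^ (2 * b + 1)"
      "v ^ (2 * b + 1) = u ^ (2 * b + 1) + 2 * p ^ a" "u = 1 \<or> v = u + 2"
      using odd_exponent_factorization[OF p(1)] assms(7) unfolding ab by metis
    show ?thesis
    proof (cases "u = 1")
      case True
      then have "(2 * p + 1) ^ (2 * b + 1) = 1 + 2 * p ^ a" using uv(1,5) by simp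
      with \<open>p > 1\<close> \<open>a = b \<or> a = b + 1\<close> have "a = 1 \<and> b = 0"
        by (intro exponents_of_trivial_factorization) auto
      then show ?thesis using ab uv(4) True by simp
    next
      case False
      with uv have v: "v = u + 2" by simp
      have "odd (u * v)" using uv(1) by simp
      then have "odd u" by simp
      then obtain m where m: "u = 2 * m + 1" by (rule oddE)
      \<comment> \<open>The midpoint of the odd numbers \<open>u\<close> and
        \<open>v = u + 2\<close> is \<open>2 * k\<close>; \<open>u \<noteq> 1\<close> gives
        \<open>k \<ge> 2\<close>.\<close>
      define k where "k = int m + 1"
      have k: "k \<ge> 2" "int u = 2 * k - 1" "int v = 2 * k + 1"
        using False m v by (simp_all add: k_def)
      have fact: "int (2 * p + 1) = (2 * k - 1) * (2 * k + 1)"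
        using uv(1) k by (metis of_nat_mult)
      then have pk: "int p = 2 * k\<^sup>2 - 1" by (simp add: power2_eq_square algebra_simps)
      have "gcd (2 * k - 1) (2 * k + 1) = 1"
        using uv(2) unfolding k(2,3)[symmetric] by simp
      moreover have "(2 * k + 1) ^ (2 * b + 1) - (2 * k - 1) ^ (2 * b + 1) = 2 * (2 * k\<^sup>2 - 1) ^ a"
      proof -
        have "int (v ^ (2 * b + 1)) = int (u ^ (2 * b + 1) + 2 * p ^ a)"
          using uv(5) by (rule arg_cong)
        then show ?thesis unfolding pk[symmetric] k(2,3)[symmetric] by simp
      qed
      moreover have "int b < \<lceil>log 2 (real_of_int (2 * k\<^sup>2 - 1))\<rceil>"
      proof -
        have "2 ^ b < p"
          using two_power_less_if_gap_two_factorization[of p a b u] p \<open>p > 1\<close> \<open>a > 0\<close>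
            \<open>a = b \<or> a = b + 1\<close> uv(1,5) unfolding v by blast
        \<comment> \<open>For an integer \<open>b\<close>, lying below a real number is the same as
          lying below its ceiling.\<close>
        then have "real b < log 2 (real p)" by (rule less_log2_of_power)
        then show ?thesis unfolding pk[symmetric] by (simp add: less_ceiling_iff)
      qed
      moreover have "composite (2 * p + 1)"
      proof -
        have "\<not> prime (u * v)"
        proof
          assume "prime (u * v)"
          then have "u = 1 \<or> v = 1" by (rule prime_product)
          with False v show False by simp
        qed
        then show ?thesis using uv(1) \<open>p > 1\<close> by (simp add: composite_def)
      qed
      ultimately have ii
        using k(1) \<open>a > 0\<close> ab pk fact unfolding ii_def
        by (intro conjI exI[of _ k] exI[of _ a] exI[of _ b]) auto
      then show ?thesis ..
    qed
  qed
  ultimately have "(x = 2 \<and> y = 1 \<and> z = p + 1) \<longleftrightarrow> \<not> ii" by blast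
  then show ?thesis unfolding ii_def .
qed

end
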